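(* Let $p\ge 1$, $K\ge 1$ be integers, $N=pK$, $R>0$, and let $\mathbf{L}=(L_1,\dots,L_p)$ be any vector of $p$ nonnegative constants. Put $L_{\min}=\min_{i=1,\dots,p}L_i$ and $\overline{L}=\sum_{i=1}^p L_i$. For any block coordinate algorithm (the same algorithm, with the same fixed parameter values such as step-sizes, being used for all three quantities below), any performance criterion $\mathcal{P}$ and any initial measure $\mathcal{I}$, one has $$\mathcal{W}_{L_{\min}}(p,K,R)\;\le\;\mathcal{W}^{\mathrm{coord}}_{\mathbf{L}}(p,K,R)\;\le\;\mathcal{W}_{\overline{L}}(p,K,R),$$ where $\mathcal{W}^{\mathrm{coord}}_{\mathbf{L}}(p,K,R)$ is the worst-case performance of the algorithm over the class $\mathcal{F}^{\mathrm{coord}}_{\mathbf{L}}$ of convex $\mathbf{L}$-coordinate-wise smooth functions, and $\mathcal{W}_{L}(p,K,R)$ is the value of the performance estimation problem of the algorithm for the class $\mathcal{F}_{L}$ of convex $L$-smooth functions.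
   Context: Blocks. $\mathbb{R}^d=\mathbb{R}^{d_1}\times\dots\times\mathbb{R}^{d_p}$ is fixed, with selection matrices $U_i\in\mathbb{R}^{d\times d_i}$ such that $(U_1,\dots,U_p)$ is the $d\times d$ identity; $x_i=U_i^Tx$ for $x\in\mathbb{R}^d$, and $\nabla_i f(x)=U_i^T\nabla f(x)$. Norms are Euclidean. Function classes. All functions are differentiable, convex, and defined on all of $\mathbb{R}^d$. $\mathcal{F}_L$ is the set of such $f$ with $\|\nabla f(x+h)-\nabla f(x)\|\le L\|h\|$ for all $x,h\in\mathbb{R}^d$. $\mathcal{F}^{\mathrm{coord}}_{\mathbf{L}}$ is the set of such $f$ with $\|\nabla_i f(x+U_ih_i)-\nabla_i f(x)\|\le L_i\|h_i\|$ for all $i\in\{1,\dots,p\}$, $x\in\mathbb{R}^d$, $h_i\in\mathbb{R}^{d_i}$. Algorithms. A block coordinate algorithm run for $K$ cycles ($N=pK$ steps) is described by a finite index set $J\supseteq\{0,\dots,N\}$ (indexing the iterates $x^{(0)},\dots,x^{(N)}$ and any auxiliary points at which partial gradients are evaluated) and by a set of admissible families $(x^{(n)},g^{(n)},f^{(n)})_{n\in J}$ in $\mathbb{R}^d\times\mathbb{R}^d\times\mathbb{R}$, namely those satisfying the update rules of the algorithm with $g^{(n)}$ in the role of the gradient at $x^{(n)}$ and $f^{(n)}$ in the role of the function value. For example, cyclic coordinate descent with step-size $\alpha$ has rules $x^{(n)}=x^{(n-1)}-\alpha U_ig^{(n-1)}_i$ for $n=1,\dots,N$, with $i=\mathrm{mod}(n,p)+1$;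 alternating minimization has rules $x^{(n)}_j=x^{(n-1)}_j$ for $j\ne i$ and $g^{(n)}_i=0$, with the same $i$. A run of the algorithm on $f$ is a family of points $(x^{(n)})_{n\in J}$ such that $(x^{(n)},\nabla f(x^{(n)}),f(x^{(n)}))_{n\in J}$ is admissible. Criteria. Write $\mathcal{O}=\{(x^{(n)},g^{(n)},f^{(n)})\}_{n\in J\cup\{*\}}$, where the index $*$ stands for a minimizer. The performance criterion $\mathcal{P}$ and the initial measure $\mathcal{I}$ are real-valued functions of $\mathcal{O}$ (e.g. $\mathcal{P}(\mathcal{O})=f^{(N)}-f^{( * )}$ or $\|g^{(N)}\|^2$, and $\mathcal{I}(\mathcal{O})=\|x^{(0)}-x^{( * )}\|^2$). Performance estimation problem. $\mathcal{W}_L(p,K,R)$ is the supremum (in the extended reals) of $\mathcal{P}(\mathcal{O})$ over all $\mathcal{O}$ such that: (i) $g^{( * )}=0$; (ii) for all $n,l\in J\cup\{*\}$, $$f^{(n)}\ge f^{(l)}+\sum_{i=1}^p\langle g^{(l)}_i,x^{(n)}_i-x^{(l)}_i\rangle+\frac{1}{2L}\sum_{i=1}^p\|g^{(n)}_i-g^{(l)}_i\|^2$$ (when $L=0$, the last term is read as $0$ if $g^{(n)}=g^{(l)}$ and as $+\infty$ otherwise); (iii) $\mathcal{I}(\mathcal{O})\le R^2$; (iv) $(x^{(n)},g^{(n)},f^{(n)})_{n\in J}$ is admissible for the algorithm. Coordinate-wise worst case. $\mathcal{W}^{\mathrm{coord}}_{\mathbf{L}}(p,K,R)$ is the supremum (in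 the extended reals) of $\mathcal{P}(\mathcal{O})$ over all $f\in\mathcal{F}^{\mathrm{coord}}_{\mathbf{L}}$, all minimizers $x^{( * )}$ of $f$, and all runs $(x^{(n)})_{n\in J}$ of the algorithm on $f$ such that $\mathcal{I}(\mathcal{O})\le R^2$, where $\mathcal{O}=\{(x^{(n)},\nabla f(x^{(n)}),f(x^{(n)}))\}_{n\in J\cup\{*\}}$. *)

theory Defs
  imports "HOL-Analysis.Analysis"
begin

section \<open>Blocks\<close>

text \<open>
  The decomposition of \<open>\<real>\<^sup>d\<close> into \<open>p\<close> blocks is given by a map \<open>b\<close> sending every coordinate to
  the number, in \<open>{1..p}\<close>, of its block; \<open>d\<^sub>i\<close> is the number of coordinates sent to \<open>i\<close>.
  The index type of the coordinates carries no order, so that listing them block by block is no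
  restriction.

  As the type of \<open>x\<^sub>i = U\<^sub>i\<^sup>T x \<in> \<real>\<^bsup>d\<^sub>i\<^esup>\<close> would depend on the value \<open>i\<close>, it is represented by
  \<open>U\<^sub>i x\<^sub>i\<close>, which is \<open>x\<close> with all coordinates outside block \<open>i\<close> replaced by \<open>0\<close>. This is an isometry
  from \<open>\<real>\<^bsup>d\<^sub>i\<^esup>\<close> onto its image, so norms and inner products of blocks are unaffected.
\<close>

definition block_map :: "nat \<Rightarrow> ('d::finite \<Rightarrow> nat) \<Rightarrow> bool" where
  "block_map p b \<longleftrightarrow> range b \<subseteq> {1..p}"

definition blk :: "('d::finite \<Rightarrow> nat) \<Rightarrow> nat \<Rightarrow> real^'d \<Rightarrow> real^'d" where
  "blk b i x = (\<chi> j. if b j = i then x $ j else 0)"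

lemma sum_blk:
  assumes "block_map p b"
  shows "(\<Sum>i=1..p. blk b i x) = x"
proof (rule vec_eq_iff[THEN iffD2], rule allI)
  fix j
  have "b j \<in> {1..p}" using assms unfolding block_map_def by blast
  then show "(\<Sum>i=1..p. blk b i x) $ j = x $ j"
    by (simp add: blk_def sum.delta)
qed


section \<open>Coordinate-wise smooth convex functions\<close>

definition grad :: "('a::real_inner \<Rightarrow> real) \<Rightarrow> 'a \<Rightarrow> 'a" where
  "grad f x = (THE D. GDERIV f x :> D)"

lemma GDERIV_grad:
  fixes f :: "'a::euclidean_space \<Rightarrow> real"
  assumes "f differentiable (at x)"
  shows "GDERIV f x :> grad f x"
proof -
  obtain f' where f': "(f has_derivative f') (at x)"
    using assms by (auto simp: differentiable_def)
  have eq: "f' = (\<lambda>h. h \<bullet> adjoint f' 1)"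
    using adjoint_works[OF has_derivative_linear[OF f'], of _ 1] by simp
  then have ex: "GDERIV f x :> adjoint f' 1"
    using f' unfolding gderiv_def by (subst eq[symmetric])
  have "D = adjoint f' 1" if "GDERIV f x :> D" for D
  proof -
    have "(\<lambda>h. h \<bullet> D) = (\<lambda>h. h \<bullet> adjoint f' 1)"
      using that ex unfolding gderiv_def by (rule has_derivative_unique)
    then show ?thesis by (metis vector_eq_ldot)
  qed
  with ex show ?thesis unfolding grad_def by (rule theI)
qed

text \<open>The increments \<open>U\<^sub>i h\<^sub>i\<close> with \<open>h\<^sub>i \<in> \<real>\<^bsup>d\<^sub>i\<^esup>\<close> are exactly the vectors \<open>blk b i h\<close>, \<open>h \<in> \<real>\<^sup>d\<close>.\<close>

definition F_coord :: "nat \<Rightarrow> ('d::finite \<Rightarrow> nat) \<Rightarrow> (nat \<Rightarrow> real) \<Rightarrow> (real^'d \<Rightarrow> real) set" where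
  "F_coord p b L = {f.
     (\<forall>x. f differentiable (at x)) \<and> convex_on UNIV f \<and>
     (\<forall>i\<in>{1..p}. \<forall>x h.
        norm (blk b i (grad f (x + blk b i h)) - blk b i (grad f x)) \<le> L i * norm (blk b i h))}"


section \<open>Algorithms\<close>

text \<open>
  A triple \<open>(x, g, v)\<close> consists of a point and of vectors and numbers in the roles of the gradient
  and of the function value at this point. Families indexed by a set are functions that are
  \<^const>\<open>undefined\<close> outside of this set, so that whatever is asserted about a family depends only on
  its members. In a family with index set \<open>J \<union> {*}\<close>, the indices are \<open>Some n\<close> for \<open>n \<in> J\<close>, and
  \<open>None\<close> for \<open>*\<close>.
\<close>

type_synonym 'd triple = "(real^'d) \<times> (real^'d) \<times> real"

text \<open>\<open>J\<close> is the index set and \<open>A\<close> the set of admissible families of the algorithm.\<close>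

definition block_coordinate_algorithm ::
  "nat \<Rightarrow> nat \<Rightarrow> nat set \<Rightarrow> (nat \<Rightarrow> ('d::finite) triple) set \<Rightarrow> bool" where
  "block_coordinate_algorithm p K J A \<longleftrightarrow>
     finite J \<and> {0..p * K} \<subseteq> J \<and> A \<subseteq> (J \<rightarrow>\<^sub>E UNIV)"

definition star_index :: "nat set \<Rightarrow> nat option set" where
  "star_index J = insert None (Some ` J)"


section \<open>Performance estimation problem\<close>

definition curvature_term ::
  "nat \<Rightarrow> ('d::finite \<Rightarrow> nat) \<Rightarrow> real \<Rightarrow> real^'d \<Rightarrow> real^'d \<Rightarrow> ereal" where
  "curvature_term p b L g g' =
     (if L = 0 then (if g = g' then 0 else \<infinity>)
      else ereal (1 / (2 * L) * (\<Sum>i=1..p. (norm (blk b i g - blk b i g'))\<^sup>2)))"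

fun interpolation_ineq ::
  "nat \<Rightarrow> ('d::finite \<Rightarrow> nat) \<Rightarrow> real \<Rightarrow> 'd triple \<Rightarrow> 'd triple \<Rightarrow> bool" where
  "interpolation_ineq p b L (xn, gn, fn) (xl, gl, fl) \<longleftrightarrow>
     ereal fn \<ge> ereal (fl + (\<Sum>i=1..p. blk b i gl \<bullet> (blk b i xn - blk b i xl)))
                 + curvature_term p b L gn gl"

definition pep_feasible ::
  "nat \<Rightarrow> ('d::finite \<Rightarrow> nat) \<Rightarrow> nat set \<Rightarrow> (nat \<Rightarrow> 'd triple) set \<Rightarrow>
   ((nat option \<Rightarrow> 'd triple) \<Rightarrow> real) \<Rightarrow> real \<Rightarrow> real \<Rightarrow> (nat option \<Rightarrow> 'd triple) set" where
  "pep_feasible p b J A I L R = {O' \<in> star_index J \<rightarrow>\<^sub>E UNIV.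
     fst (snd (O' None)) = 0 \<and>
     (\<forall>n\<in>star_index J. \<forall>l\<in>star_index J. interpolation_ineq p b L (O' n) (O' l)) \<and>
     I O' \<le> R\<^sup>2 \<and>
     (\<lambda>n\<in>J. O' (Some n)) \<in> A}"

definition W_pep ::
  "nat \<Rightarrow> ('d::finite \<Rightarrow> nat) \<Rightarrow> nat set \<Rightarrow> (nat \<Rightarrow> 'd triple) set \<Rightarrow>
   ((nat option \<Rightarrow> 'd triple) \<Rightarrow> real) \<Rightarrow> ((nat option \<Rightarrow> 'd triple) \<Rightarrow> real) \<Rightarrow>
   real \<Rightarrow> real \<Rightarrow> ereal" where
  "W_pep p b J A P I L R = (SUP O' \<in> pep_feasible p b J A I L R. ereal (P O'))"


section \<open>Coordinate-wise worst case\<close>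

definition minimizer :: "('a \<Rightarrow> real) \<Rightarrow> 'a \<Rightarrow> bool" where
  "minimizer f z \<longleftrightarrow> (\<forall>y. f z \<le> f y)"

definition oracle_family ::
  "'i set \<Rightarrow> (real^'d \<Rightarrow> real) \<Rightarrow> ('i \<Rightarrow> real^'d) \<Rightarrow> 'i \<Rightarrow> ('d::finite) triple" where
  "oracle_family S f x = (\<lambda>n\<in>S. (x n, grad f (x n), f (x n)))"

definition run_on ::
  "nat set \<Rightarrow> (nat \<Rightarrow> ('d::finite) triple) set \<Rightarrow> (real^'d \<Rightarrow> real) \<Rightarrow> (nat \<Rightarrow> real^'d) \<Rightarrow> bool" where
  "run_on J A f x \<longleftrightarrow> oracle_family J f x \<in> A"

definition W_coord ::
  "nat \<Rightarrow> ('d::finite \<Rightarrow> nat) \<Rightarrow> nat set \<Rightarrow> (nat \<Rightarrow> 'd triple) set \<Rightarrow>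
   ((nat option \<Rightarrow> 'd triple) \<Rightarrow> real) \<Rightarrow> ((nat option \<Rightarrow> 'd triple) \<Rightarrow> real) \<Rightarrow>
   (nat \<Rightarrow> real) \<Rightarrow> real \<Rightarrow> ereal" where
  "W_coord p b J A P I L R =
     Sup {ereal (P (oracle_family (star_index J) f x)) | f x.
            f \<in> F_coord p b L \<and>
            minimizer f (x None) \<and>
            run_on J A f (\<lambda>n. x (Some n)) \<and>
            I (oracle_family (star_index J) f x) \<le> R\<^sup>2}"

end

theory Submission
  imports Defs
begin

text \<open>
  Both inequalities are inclusions between the sets of values over which the suprema are taken.

  For \<open>L > 0\<close>, a differentiable convex function is \<open>L\<close>-smooth iff it satisfies the quadratic upper bound
  \<open>f y \<le> f x + \<nabla>f x \<bullet> (y - x) + L/2 \<parallel>y - x\<parallel>\<^sup>2\<close>, and iff it satisfies the interpolation inequalities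
  (\<open>cocoercive_inequality\<close>, \<open>cocoercive_imp_Lipschitz\<close>).

  For the right inequality, the triples of a coordinate-wise smooth \<open>f\<close> must satisfy the
  interpolation inequalities with \<open>\<Sum>L\<^sub>i\<close>. Write \<open>x + h\<close> as the convex combination of the points
  \<open>x + U\<^sub>i h\<^sub>i / w\<^sub>i\<close> with weights \<open>w\<^sub>i = L\<^sub>i / \<Sum>L\<^sub>j\<close>, each of which differs from \<open>x\<close> in one block only.
  Convexity and the quadratic upper bound in each block then yield the quadratic upper bound with
  \<open>\<Sum>L\<^sub>i\<close> in all directions, since \<open>w\<^sub>i \<cdot> L\<^sub>i / (2 w\<^sub>i\<^sup>2) = (\<Sum>L\<^sub>j) / 2\<close>
  (\<open>F_coord_quadratic_upper_pos\<close>). Constants \<open>L\<^sub>i = 0\<close> are reached as limits of positive ones.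

  For the left inequality, every feasible family must come from a function. If \<open>L > 0\<close>, an
  \<open>L\<close>-smooth convex interpolant is the Moreau envelope of the maximum of the affine functions
  \<open>z \<mapsto> f\<^sub>j + g\<^sub>j \<bullet> (z - x\<^sub>j) + \<parallel>g\<^sub>j\<parallel>\<^sup>2 / (2L)\<close> (\<open>smooth_convex_interpolation\<close>): the \<open>j\<close>-th
  function alone has as its envelope the tangent at \<open>x\<^sub>j\<close>, and the interpolation inequalities say
  exactly that the \<open>j\<close>-th function is active at \<open>x\<^sub>j - g\<^sub>j / L\<close>, which is thus the proximal
  point of \<open>x\<^sub>j\<close>. If \<open>L = 0\<close>, all gradients are \<open>0\<close> and a constant function interpolates.
  With \<open>L = min L\<^sub>i\<close>, the interpolant is smooth in every block.
\<close>


section \<open>Gradients of convex functions\<close>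

lemma GDERIV_unique:
  assumes "GDERIV f x :> D" "GDERIV f x :> E"
  shows "D = E"
proof -
  have "(\<lambda>h. h \<bullet> D) = (\<lambda>h. h \<bullet> E)"
    using assms unfolding gderiv_def by (rule has_derivative_unique)
  then show ?thesis by (metis vector_eq_ldot)
qed

lemma grad_eqI:
  assumes "GDERIV f x :> D"
  shows "grad f x = D"
  unfolding grad_def using assms GDERIV_unique by (blast intro: the_equality)

lemma GDERIV_imp_differentiable: "GDERIV f x :> D \<Longrightarrow> f differentiable (at x)"
  unfolding gderiv_def differentiable_def by blast

lemma GDERIV_along_line:
  assumes "GDERIV f (x + t *\<^sub>R h) :> D"
  shows "((\<lambda>t. f (x + t *\<^sub>R h)) has_field_derivative h \<bullet> D) (at t)"
proof -
  have 1: "((\<lambda>t. x + t *\<^sub>R h) has_derivative (\<lambda>s. s *\<^sub>R h)) (at t)"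
    by (auto intro!: derivative_eq_intros)
  have 2: "(f has_derivative (\<lambda>k. k \<bullet> D)) (at (x + t *\<^sub>R h))"
    using assms unfolding gderiv_def .
  have "((\<lambda>t. f (x + t *\<^sub>R h)) has_derivative (\<lambda>s. (s *\<^sub>R h) \<bullet> D)) (at t)"
    using has_derivative_compose[OF 1 2] .
  then show ?thesis
    unfolding has_field_derivative_def by (simp add: mult.commute[of _ "h \<bullet> D"])
qed

lemma convex_above_tangent:
  assumes f: "convex_on UNIV f" and D: "GDERIV f x :> D"
  shows "f x + D \<bullet> (y - x) \<le> f y"
proof -
  let ?\<phi> = "\<lambda>t. f (x + t *\<^sub>R (y - x))"
  have "convex_on UNIV ?\<phi>"
  proof (rule convex_onI)
    fix t a b :: real assume t: "0 < t" "t < 1"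
    have eq: "x + ((1 - t) *\<^sub>R a + t *\<^sub>R b) *\<^sub>R (y - x)
        = (1 - t) *\<^sub>R (x + a *\<^sub>R (y - x)) + t *\<^sub>R (x + b *\<^sub>R (y - x))"
      by (simp add: algebra_simps)
    show "?\<phi> ((1 - t) *\<^sub>R a + t *\<^sub>R b) \<le> (1 - t) * ?\<phi> a + t * ?\<phi> b"
      unfolding eq by (rule convex_onD[OF f]) (use t in auto)
  qed simp
  moreover have "(?\<phi> has_field_derivative (y - x) \<bullet> D) (at 0)"
    by (rule GDERIV_along_line) (use D in simp)
  ultimately have "?\<phi> 1 - ?\<phi> 0 \<ge> (y - x) \<bullet> D * (1 - 0)"
    by (intro convex_on_imp_above_tangent[where A = UNIV]) auto
  then show ?thesis by (simp add: inner_commute)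
qed

lemma minimizer_GDERIV_eq_0:
  assumes "minimizer f z" "GDERIV f z :> D"
  shows "D = 0"
proof -
  have "(\<lambda>h. h \<bullet> D) = (\<lambda>h. 0)"
    by (rule differential_zero_maxmin[of z UNIV f])
       (use assms in \<open>auto simp: minimizer_def gderiv_def\<close>)
  then show ?thesis by (metis inner_eq_zero_iff)
qed


section \<open>Quadratic upper bounds\<close>

text \<open>
  The derivative of \<open>t \<mapsto> f (x + t h)\<close> grows at most linearly, at rate \<open>M \<parallel>h\<parallel>\<^sup>2\<close>. Only increments
  along \<open>h\<close> matter, so the lemma applies to smoothness in a single block.
\<close>

lemma quadratic_upper_along_line:
  assumes deriv: "\<And>t. GDERIV f (x + t *\<^sub>R h) :> G t"
    and lip: "\<And>t. 0 \<le> t \<Longrightarrow> h \<bullet> (G t - G 0) \<le> M * t * (norm h)\<^sup>2"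
  shows "f (x + h) \<le> f x + G 0 \<bullet> h + M / 2 * (norm h)\<^sup>2"
proof -
  let ?\<psi> = "\<lambda>t. f (x + t *\<^sub>R h) - t * (h \<bullet> G 0) - M / 2 * (norm h)\<^sup>2 * t\<^sup>2"
  have "?\<psi> 0 \<ge> ?\<psi> 1"
  proof (rule DERIV_nonpos_imp_nonincreasing[where f = ?\<psi>])
    fix t :: real assume t: "0 \<le> t" "t \<le> 1"
    have "(?\<psi> has_field_derivative h \<bullet> G t - h \<bullet> G 0 - M * t * (norm h)\<^sup>2) (at t)"
      by (auto intro!: derivative_eq_intros GDERIV_along_line deriv)
    moreover have "h \<bullet> G t - h \<bullet> G 0 - M * t * (norm h)\<^sup>2 \<le> 0"
      using lip[OF t(1)] by (simp add: inner_diff_right)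
    ultimately show "\<exists>y. (?\<psi> has_field_derivative y) (at t) \<and> y \<le> 0" by blast
  qed simp
  then show ?thesis by (simp add: inner_commute)
qed

text \<open>
  The tangent of \<open>f\<close> at \<open>x\<close> is a lower bound, the quadratic bound at \<open>y\<close> an upper bound. Compare
  them at the gradient step \<open>y - (g y - g x) / L\<close> for \<open>f\<close> minus its tangent at \<open>x\<close>.
\<close>

lemma cocoercive_inequality:
  fixes f :: "'a::real_inner \<Rightarrow> real"
  assumes L: "L > 0"
    and lower: "\<And>x y. f x + g x \<bullet> (y - x) \<le> f y"
    and upper: "\<And>x y. f y \<le> f x + g x \<bullet> (y - x) + L / 2 * (norm (y - x))\<^sup>2"
  shows "f x + g x \<bullet> (y - x) + 1 / (2 * L) * (norm (g y - g x))\<^sup>2 \<le> f y"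
proof -
  define d where "d = g y - g x"
  define z where "z = y - (1 / L) *\<^sub>R d"
  have 1: "g x \<bullet> (z - x) = g x \<bullet> (y - x) - (g x \<bullet> d) / L"
    and 2: "g y \<bullet> (z - y) = - (g y \<bullet> d) / L"
    by (simp_all add: z_def inner_diff_right)
  have 3: "(norm (z - y))\<^sup>2 = (norm d)\<^sup>2 / L\<^sup>2"
    using L by (simp add: z_def power_divide)
  have 4: "(g y \<bullet> d) / L - (g x \<bullet> d) / L = (norm d)\<^sup>2 / L"
    by (simp add: d_def inner_diff_left power2_norm_eq_inner diff_divide_distrib)
  have 5: "L / 2 * ((norm d)\<^sup>2 / L\<^sup>2) = (norm d)\<^sup>2 / L - 1 / (2 * L) * (norm d)\<^sup>2"
    using L by (simp add: field_simps power2_eq_square)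
  have "f x + g x \<bullet> (z - x) \<le> f y + g y \<bullet> (z - y) + L / 2 * (norm (z - y))\<^sup>2"
    using lower[of x z] upper[of z y] by linarith
  then show ?thesis unfolding 1 2 3 5 using 4 by (simp add: d_def)
qed

lemma cocoercive_imp_Lipschitz:
  fixes f :: "'a::real_inner \<Rightarrow> real"
  assumes L: "L > 0"
    and coco: "\<And>x y. f x + g x \<bullet> (y - x) + 1 / (2 * L) * (norm (g y - g x))\<^sup>2 \<le> f y"
  shows "norm (g y - g x) \<le> L * norm (y - x)"
proof -
  have eq: "g y \<bullet> (x - y) = - (g y \<bullet> (y - x))"
    by (simp add: inner_diff_right)
  have "1 / L * (norm (g y - g x))\<^sup>2 \<le> (g y - g x) \<bullet> (y - x)"
    using coco[of x y] coco[of y x]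
    by (simp add: norm_minus_commute[of "g x"] inner_diff_left eq field_simps)
  also have "\<dots> \<le> norm (g y - g x) * norm (y - x)"
    by (rule norm_cauchy_schwarz)
  finally have "norm (g y - g x) * norm (g y - g x) \<le> norm (g y - g x) * (L * norm (y - x))"
    using L by (simp add: field_simps power2_eq_square)
  then show ?thesis
    using L by (cases "g y = g x") auto
qed

text \<open>The degenerate case \<open>L = 0\<close>: \<open>f\<close> coincides with each of its tangents, so it is affine.\<close>

lemma affine_upper_imp_const_gradient:
  fixes f :: "'a::real_inner \<Rightarrow> real"
  assumes lower: "\<And>x y. f x + g x \<bullet> (y - x) \<le> f y"
    and upper: "\<And>x y. f y \<le> f x + g x \<bullet> (y - x)"
  shows "g x = g y"
proof -
  have "g x \<bullet> h \<le> g y \<bullet> h" for h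
  proof -
    have eq: "f (y + s *\<^sub>R h) = f y + s * (g y \<bullet> h)" for s
      using lower[of y "y + s *\<^sub>R h"] upper[of "y + s *\<^sub>R h" y] by simp
    have eq2: "f (x + h) = f x + g x \<bullet> h" "f (y + h) = f y + g y \<bullet> h"
      using lower[of x "x + h"] upper[of "x + h" x] eq[of 1] by auto
    have "f (y + h) = f x + g x \<bullet> (y + h - x)" "f y = f x + g x \<bullet> (y - x)"
      by (meson antisym lower upper)+
    then show ?thesis using eq2 by (simp add: inner_diff_right inner_add_right)
  qed
  from this[of "g x - g y"] have "(g x - g y) \<bullet> (g x - g y) \<le> 0"
    by (simp add: inner_diff_left)
  then show ?thesis by (metis antisym eq_iff_diff_eq_0 inner_eq_zero_iff inner_ge_zero)
qed

text \<open>
  At \<open>x\<close>, convexity reflects a quadratic upper bound for the displacement \<open>-d\<close> into a quadratic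
  lower bound for \<open>d\<close>.
\<close>

lemma convex_quadratic_upper_imp_GDERIV:
  fixes f :: "'a::real_inner \<Rightarrow> real"
  assumes f: "convex_on UNIV f" and M: "M \<ge> 0"
    and upper: "\<And>d. f (x + d) \<le> f x + D \<bullet> d + M * (norm d)\<^sup>2"
  shows "GDERIV f x :> D"
proof -
  have lower: "f (x + d) \<ge> f x + D \<bullet> d - M * (norm d)\<^sup>2" for d
  proof -
    have "f ((1 - 1/2) *\<^sub>R (x + d) + (1/2) *\<^sub>R (x - d)) \<le> (1 - 1/2) * f (x + d) + 1/2 * f (x - d)"
      by (rule convex_onD[OF f]) auto
    moreover have "(1 - 1/2::real) *\<^sub>R (x + d) + (1/2) *\<^sub>R (x - d) = x"
      by (simp add: algebra_simps flip: scaleR_add_left)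
    ultimately have "2 * f x \<le> f (x + d) + f (x - d)" by simp
    then show ?thesis using upper[of "- d"] by simp
  qed
  have bound: "\<bar>f y - f x - (y - x) \<bullet> D\<bar> \<le> M * (norm (y - x))\<^sup>2" for y
    using lower[of "y - x"] upper[of "y - x"] by (simp add: inner_commute abs_le_iff)
  show ?thesis unfolding gderiv_def has_derivative_at_alt
  proof (intro conjI allI impI)
    show "bounded_linear (\<lambda>h. h \<bullet> D)" by (rule bounded_linear_inner_left)
    fix e :: real assume e: "e > 0"
    show "\<exists>d>0. \<forall>y. norm (y - x) < d \<longrightarrow>
        norm (f y - f x - (y - x) \<bullet> D) \<le> e * norm (y - x)"
    proof (intro exI conjI allI impI)
      show "e / (M + 1) > 0" using e M by simp
      fix y assume y: "norm (y - x) < e / (M + 1)"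
      have "M * norm (y - x) \<le> (M + 1) * norm (y - x)" by (simp add: distrib_right)
      also have "\<dots> \<le> e" using y M by (simp add: field_simps)
      finally have "M * norm (y - x) * norm (y - x) \<le> e * norm (y - x)"
        by (rule mult_right_mono) simp
      then show "norm (f y - f x - (y - x) \<bullet> D) \<le> e * norm (y - x)"
        using bound[of y] by (simp add: power2_eq_square mult.assoc)
    qed
  qed
qed


section \<open>Moreau envelopes\<close>

text \<open>The constant \<open>L\<close>, which becomes the smoothness constant, is the inverse of the usual parameter.\<close>

definition moreau_envelope :: "('a::euclidean_space \<Rightarrow> real) \<Rightarrow> real \<Rightarrow> 'a \<Rightarrow> real" where
  "moreau_envelope h L x = (INF z. h z + L / 2 * (norm (x - z))\<^sup>2)"

definition prox_point :: "('a::euclidean_space \<Rightarrow> real) \<Rightarrow> real \<Rightarrow> 'a \<Rightarrow> 'a \<Rightarrow> bool" where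
  "prox_point h L x z \<longleftrightarrow>
     (\<forall>w. h z + L / 2 * (norm (x - z))\<^sup>2 \<le> h w + L / 2 * (norm (x - w))\<^sup>2)"

lemma moreau_envelope_prox_point:
  assumes "prox_point h L x z"
  shows "moreau_envelope h L x = h z + L / 2 * (norm (x - z))\<^sup>2"
  unfolding moreau_envelope_def
  by (rule cInf_eq_minimum) (use assms in \<open>auto simp: prox_point_def\<close>)

text \<open>
  The quadratic term dominates the affine minorant, so the minimization can be restricted to a
  closed ball, on which the convex function \<open>h\<close> is continuous.
\<close>

lemma prox_point_exists:
  fixes h :: "'a::euclidean_space \<Rightarrow> real"
  assumes L: "L > 0" and h: "convex_on UNIV h" and minorant: "\<And>z. a + c \<bullet> z \<le> h z"
  shows "\<exists>z. prox_point h L x z"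
proof -
  let ?F = "\<lambda>z. h z + L / 2 * (norm (x - z))\<^sup>2"
  define m where "m = h x - a - c \<bullet> x"
  define \<rho> where "\<rho> = 1 + 2 * (norm c + m) / L"
  have m: "m \<ge> 0" using minorant[of x] by (simp add: m_def)
  have \<rho>: "\<rho> \<ge> 1" using m L by (simp add: \<rho>_def)
  have "continuous_on UNIV h" by (rule convex_on_continuous) (use h in auto)
  then have "continuous_on (cball x \<rho>) h" by (rule continuous_on_subset) simp
  then have "continuous_on (cball x \<rho>) ?F" by (intro continuous_intros)
  moreover have "cball x \<rho> \<noteq> {}" using \<rho> by simp
  ultimately obtain z where z: "\<And>w. w \<in> cball x \<rho> \<Longrightarrow> ?F z \<le> ?F w"
    using continuous_attains_inf[OF compact_cball, of x \<rho> ?F] by blast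
  have "?F z \<le> ?F w" for w
  proof (cases "w \<in> cball x \<rho>")
    case True then show ?thesis by (rule z)
  next
    case False
    define r where "r = norm (x - w)"
    have r: "\<rho> < r" using False by (simp add: r_def dist_norm)
    have "2 * (norm c + m) / L \<le> r" using r by (simp add: \<rho>_def)
    then have "norm c + m \<le> L / 2 * r" using L by (simp add: field_simps)
    then have "(norm c + m) * r \<le> L / 2 * r * r"
      by (rule mult_right_mono) (use r \<rho> in simp)
    moreover have "m * 1 \<le> m * r" by (rule mult_left_mono) (use r \<rho> m in auto)
    ultimately have "norm c * r + m \<le> L / 2 * r\<^sup>2"
      by (simp add: power2_eq_square algebra_simps)
    moreover have "c \<bullet> (x - w) \<le> norm c * r"
      unfolding r_def by (rule norm_cauchy_schwarz)
    ultimately have "h x \<le> ?F w"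
      using minorant[of w] by (simp add: m_def r_def inner_diff_right)
    moreover have "?F z \<le> ?F x" by (rule z) (use \<rho> in simp)
    ultimately show ?thesis by simp
  qed
  then show ?thesis unfolding prox_point_def by blast
qed

text \<open>The minimand is jointly convex in the two points.\<close>

lemma moreau_envelope_convex:
  fixes h :: "'a::euclidean_space \<Rightarrow> real"
  assumes L: "L \<ge> 0" and h: "convex_on UNIV h" and prox: "\<And>x. \<exists>z. prox_point h L x z"
  shows "convex_on UNIV (moreau_envelope h L)"
proof (rule convex_onI)
  fix t :: real and x y :: 'a assume t: "0 < t" "t < 1"
  obtain u v w where u: "prox_point h L x u" and v: "prox_point h L y v"
    and w: "prox_point h L ((1 - t) *\<^sub>R x + t *\<^sub>R y) w"
    using prox by meson
  let ?w = "(1 - t) *\<^sub>R u + t *\<^sub>R v"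
  let ?a = "x - u" and ?b = "y - v"
  have "moreau_envelope h L ((1 - t) *\<^sub>R x + t *\<^sub>R y)
      \<le> h ?w + L / 2 * (norm ((1 - t) *\<^sub>R x + t *\<^sub>R y - ?w))\<^sup>2"
    unfolding moreau_envelope_prox_point[OF w] using w unfolding prox_point_def by blast
  also have "(1 - t) *\<^sub>R x + t *\<^sub>R y - ?w = (1 - t) *\<^sub>R ?a + t *\<^sub>R ?b"
    by (simp add: algebra_simps)
  finally have 1: "moreau_envelope h L ((1 - t) *\<^sub>R x + t *\<^sub>R y)
      \<le> h ?w + L / 2 * (norm ((1 - t) *\<^sub>R ?a + t *\<^sub>R ?b))\<^sup>2" .
  have "(1 - t) * (norm ?a)\<^sup>2 + t * (norm ?b)\<^sup>2 - (norm ((1 - t) *\<^sub>R ?a + t *\<^sub>R ?b))\<^sup>2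
      = t * (1 - t) * (norm (?a - ?b))\<^sup>2"
    unfolding power2_norm_eq_inner
    by (simp only: inner_add_left inner_add_right inner_diff_left inner_diff_right
        inner_scaleR_left inner_scaleR_right inner_commute) (simp add: algebra_simps)
  moreover have "\<dots> \<ge> 0" using t by simp
  ultimately have "(norm ((1 - t) *\<^sub>R ?a + t *\<^sub>R ?b))\<^sup>2 \<le> (1 - t) * (norm ?a)\<^sup>2 + t * (norm ?b)\<^sup>2"
    by linarith
  then have "L / 2 * (norm ((1 - t) *\<^sub>R ?a + t *\<^sub>R ?b))\<^sup>2
      \<le> L / 2 * ((1 - t) * (norm ?a)\<^sup>2 + t * (norm ?b)\<^sup>2)"
    by (rule mult_left_mono) (use L in simp)
  moreover have "h ?w \<le> (1 - t) * h u + t * h v"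
    by (rule convex_onD[OF h]) (use t in auto)
  moreover have "(1 - t) * (h u + L / 2 * (norm ?a)\<^sup>2) + t * (h v + L / 2 * (norm ?b)\<^sup>2)
      = (1 - t) * h u + t * h v + L / 2 * ((1 - t) * (norm ?a)\<^sup>2 + t * (norm ?b)\<^sup>2)"
    by (simp add: field_simps)
  ultimately show "moreau_envelope h L ((1 - t) *\<^sub>R x + t *\<^sub>R y)
      \<le> (1 - t) * moreau_envelope h L x + t * moreau_envelope h L y"
    using 1 unfolding moreau_envelope_prox_point[OF u] moreau_envelope_prox_point[OF v]
    by linarith
qed simp

text \<open>Keep the proximal point \<open>z\<close> of \<open>x\<close> as a competitor at \<open>x + d\<close>.\<close>

lemma moreau_envelope_quadratic_upper:
  assumes z: "prox_point h L x z" and prox: "\<And>x. \<exists>z. prox_point h L x z"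
  shows "moreau_envelope h L (x + d)
    \<le> moreau_envelope h L x + (L *\<^sub>R (x - z)) \<bullet> d + L / 2 * (norm d)\<^sup>2"
proof -
  obtain w where w: "prox_point h L (x + d) w" using prox by blast
  have "moreau_envelope h L (x + d) \<le> h z + L / 2 * (norm (x + d - z))\<^sup>2"
    unfolding moreau_envelope_prox_point[OF w] using w unfolding prox_point_def by blast
  also have "(norm (x + d - z))\<^sup>2 = (norm (x - z))\<^sup>2 + 2 * ((x - z) \<bullet> d) + (norm d)\<^sup>2"
    unfolding power2_norm_eq_inner by (simp add: algebra_simps inner_commute)
  finally show ?thesis unfolding moreau_envelope_prox_point[OF z] by (simp add: algebra_simps)
qed


section \<open>Smooth convex interpolation\<close>

lemma convex_on_Max:
  assumes "finite S" "S \<noteq> {}" "\<And>i. i \<in> S \<Longrightarrow> convex_on C (f i)"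
  shows "convex_on C (\<lambda>z. Max ((\<lambda>i. f i z) ` S))"
proof (rule convex_onI)
  show "convex C" using assms by (meson convex_on_imp_convex ex_in_conv)
  fix t :: real and x y assume t: "0 < t" "t < 1" and xy: "x \<in> C" "y \<in> C"
  have "f i ((1 - t) *\<^sub>R x + t *\<^sub>R y)
      \<le> (1 - t) * Max ((\<lambda>i. f i x) ` S) + t * Max ((\<lambda>i. f i y) ` S)" if i: "i \<in> S" for i
  proof -
    have "f i ((1 - t) *\<^sub>R x + t *\<^sub>R y) \<le> (1 - t) * f i x + t * f i y"
      by (rule convex_onD[OF assms(3)[OF i]]) (use t xy in auto)
    also have "\<dots> \<le> (1 - t) * Max ((\<lambda>i. f i x) ` S) + t * Max ((\<lambda>i. f i y) ` S)"
      by (intro add_mono mult_left_mono Max_ge) (use t i assms(1) in auto)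
    finally show ?thesis .
  qed
  then show "Max ((\<lambda>i. f i ((1 - t) *\<^sub>R x + t *\<^sub>R y)) ` S)
      \<le> (1 - t) * Max ((\<lambda>i. f i x) ` S) + t * Max ((\<lambda>i. f i y) ` S)"
    using assms(1,2) by (intro Max.boundedI) auto
qed

text \<open>
  The interpolant is the Moreau envelope of a piecewise affine function. Its shift
  \<open>\<parallel>g\<^sub>j\<parallel>\<^sup>2 / (2L)\<close> compensates what the envelope takes off an affine function of slope \<open>g\<^sub>j\<close>.
\<close>

lemma smooth_convex_interpolation:
  fixes x g :: "'i \<Rightarrow> 'a::euclidean_space" and v :: "'i \<Rightarrow> real"
  assumes S: "finite S" "S \<noteq> {}" and L: "L > 0"
    and interp: "\<And>n l. n \<in> S \<Longrightarrow> l \<in> S \<Longrightarrow>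
      v l + g l \<bullet> (x n - x l) + 1 / (2 * L) * (norm (g n - g l))\<^sup>2 \<le> v n"
  obtains f D where "convex_on UNIV f" "\<And>y. GDERIV f y :> D y"
    "\<And>y z. norm (D z - D y) \<le> L * norm (z - y)"
    "\<And>n. n \<in> S \<Longrightarrow> f (x n) = v n" "\<And>n. n \<in> S \<Longrightarrow> D (x n) = g n"
proof -
  define a where "a j z = v j + g j \<bullet> (z - x j) + 1 / (2 * L) * (norm (g j))\<^sup>2" for j z
  define h where "h z = Max ((\<lambda>j. a j z) ` S)" for z
  have a_le: "a j z \<le> h z" if "j \<in> S" for j z
    unfolding h_def using S that by (intro Max_ge) auto
  have "convex_on UNIV (a j)" for j
    by (rule convex_onI) (simp_all add: a_def algebra_simps add_divide_distrib diff_divide_distrib)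
  then have h: "convex_on UNIV h"
    unfolding h_def[abs_def] using S by (intro convex_on_Max)
  obtain j where j: "j \<in> S" using S by blast
  have prox: "\<exists>z. prox_point h L y z" for y
  proof (rule prox_point_exists[OF L h])
    show "a j 0 + g j \<bullet> z \<le> h z" for z
      using a_le[OF j, of z] by (simp add: a_def inner_diff_right)
  qed
  define f where "f = moreau_envelope h L"
  define D where "D y = L *\<^sub>R (y - (SOME z. prox_point h L y z))" for y
  have some: "prox_point h L y (SOME z. prox_point h L y z)" for y
    by (rule someI_ex) (rule prox)
  have f: "convex_on UNIV f"
    unfolding f_def by (rule moreau_envelope_convex) (use L h prox in auto)
  have GD: "GDERIV f y :> L *\<^sub>R (y - z)" if "prox_point h L y z" for y z
    by (rule convex_quadratic_upper_imp_GDERIV[where M = "L / 2"])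
       (use f L moreau_envelope_quadratic_upper[OF that prox] in \<open>auto simp: f_def\<close>)
  have D: "GDERIV f y :> D y" for y
    unfolding D_def by (rule GD) (rule some)
  have upper: "f z \<le> f y + D y \<bullet> (z - y) + L / 2 * (norm (z - y))\<^sup>2" for y z
    using moreau_envelope_quadratic_upper[OF some prox, of y "z - y"]
    by (simp add: f_def D_def)
  have Lip: "norm (D z - D y) \<le> L * norm (z - y)" for y z
    by (rule cocoercive_imp_Lipschitz[OF L], rule cocoercive_inequality[OF L])
       (use convex_above_tangent[OF f D] upper in auto)
  have prox_x: "prox_point h L (x n) (x n - (1 / L) *\<^sub>R g n)"
    and f_x: "f (x n) = v n" if n: "n \<in> S" for n
  proof -
    let ?z = "x n - (1 / L) *\<^sub>R g n"
    have sq: "L / 2 * (norm (x n - ?z))\<^sup>2 = 1 / (2 * L) * (norm (g n))\<^sup>2"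
      using L by (simp add: power_divide power2_eq_square)
    have "a l ?z \<le> v n - 1 / (2 * L) * (norm (g n))\<^sup>2" if l: "l \<in> S" for l
    proof -
      have "g l \<bullet> (?z - x l) = g l \<bullet> (x n - x l) - (g l \<bullet> g n) / L"
        by (simp add: inner_diff_right)
      moreover have "(norm (g n - g l))\<^sup>2 = (norm (g n))\<^sup>2 + (norm (g l))\<^sup>2 - 2 * (g l \<bullet> g n)"
        unfolding power2_norm_eq_inner by (simp add: algebra_simps inner_commute)
      then have "1 / (2 * L) * (norm (g n - g l))\<^sup>2
          = 1 / (2 * L) * (norm (g n))\<^sup>2 + 1 / (2 * L) * (norm (g l))\<^sup>2 - (g l \<bullet> g n) / L"
        by (simp add: add_divide_distrib diff_divide_distrib)
      ultimately show ?thesis using interp[OF n l] by (simp add: a_def)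
    qed
    then have hz: "h ?z \<le> v n - 1 / (2 * L) * (norm (g n))\<^sup>2"
      unfolding h_def using S by (intro Max.boundedI) auto
    (* Completing the square: the envelope of the n-th affine function alone is v n at x n,
       with proximal point ?z. *)
    have "v n \<le> a n w + L / 2 * (norm (x n - w))\<^sup>2" for w
    proof -
      let ?e = "w - x n"
      have "0 \<le> L / 2 * (norm (w - ?z))\<^sup>2" using L by simp
      also have "w - ?z = ?e + (1 / L) *\<^sub>R g n" by simp
      also have "(norm (?e + (1 / L) *\<^sub>R g n))\<^sup>2
          = (norm ?e)\<^sup>2 + 2 / L * (g n \<bullet> ?e) + (norm (g n))\<^sup>2 / L\<^sup>2"
        unfolding power2_norm_eq_inner
        by (simp only: inner_add_left inner_add_right inner_scaleR_left inner_scaleR_right)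
          (simp add: inner_commute[of ?e "g n"] power2_eq_square add_divide_distrib)
      also have "L / 2 * \<dots> = L / 2 * (norm (x n - w))\<^sup>2 + g n \<bullet> ?e + 1 / (2 * L) * (norm (g n))\<^sup>2"
        unfolding norm_minus_commute[of w "x n"] using L by (simp add: field_simps power2_eq_square)
      finally show ?thesis by (simp add: a_def)
    qed
    then have low: "v n \<le> h w + L / 2 * (norm (x n - w))\<^sup>2" for w
      using a_le[OF n, of w] by (meson add_right_mono order_trans)
    from hz have up: "h ?z + L / 2 * (norm (x n - ?z))\<^sup>2 \<le> v n" unfolding sq by simp
    show pr: "prox_point h L (x n) ?z"
      unfolding prox_point_def using low up by (meson order_trans)
    show "f (x n) = v n"
      unfolding f_def moreau_envelope_prox_point[OF pr] using low[of ?z] up by (rule antisym[rotated])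
  qed
  have "D (x n) = g n" if "n \<in> S" for n
    using GDERIV_unique[OF D GD[OF prox_x[OF that]]] L by simp
  with that f D Lip f_x show thesis by blast
qed


section \<open>Blocks\<close>

lemma blk_diff: "blk b i (x - y) = blk b i x - blk b i y"
  by (simp add: blk_def vec_eq_iff)

lemma blk_scaleR: "blk b i (c *\<^sub>R x) = c *\<^sub>R blk b i x"
  by (simp add: blk_def vec_eq_iff)

lemma inner_blk_left: "blk b i x \<bullet> blk b i y = blk b i x \<bullet> y"
  unfolding inner_vec_def blk_def by (auto intro!: sum.cong)

lemma inner_blk_right: "blk b i x \<bullet> blk b i y = x \<bullet> blk b i y"
  unfolding inner_vec_def blk_def by (auto intro!: sum.cong)

lemma norm_blk_le: "norm (blk b i x) \<le> norm x"
  by (rule norm_le_componentwise_cart) (simp add: blk_def)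

lemma sum_inner_blk:
  assumes "block_map p b"
  shows "(\<Sum>i=1..p. blk b i x \<bullet> blk b i y) = x \<bullet> y"
proof -
  have "(\<Sum>i=1..p. blk b i x \<bullet> blk b i y) = (\<Sum>i=1..p. blk b i x) \<bullet> y"
    unfolding inner_sum_left by (simp only: inner_blk_left)
  then show ?thesis by (simp only: sum_blk[OF assms])
qed

lemma sum_norm_blk:
  assumes "block_map p b"
  shows "(\<Sum>i=1..p. (norm (blk b i x))\<^sup>2) = (norm x)\<^sup>2"
  unfolding power2_norm_eq_inner by (rule sum_inner_blk[OF assms])

lemma interpolation_ineq_iff:
  assumes "block_map p b" "L \<noteq> 0"
  shows "interpolation_ineq p b L (xn, gn, fn) (xl, gl, fl) \<longleftrightarrow>
    fl + gl \<bullet> (xn - xl) + 1 / (2 * L) * (norm (gn - gl))\<^sup>2 \<le> fn"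
  using assms(2)
  by (simp add: curvature_term_def sum_inner_blk[OF assms(1)] sum_norm_blk[OF assms(1)]
      flip: blk_diff del: One_nat_def)

lemma interpolation_ineq_0_iff:
  assumes "block_map p b"
  shows "interpolation_ineq p b 0 (xn, gn, fn) (xl, gl, fl) \<longleftrightarrow>
    gn = gl \<and> fl + gl \<bullet> (xn - xl) \<le> fn"
  by (simp add: curvature_term_def sum_inner_blk[OF assms] flip: blk_diff del: One_nat_def)


section \<open>Coordinate-wise smoothness implies smoothness\<close>

lemma F_coord_GDERIV: "f \<in> F_coord p b L \<Longrightarrow> GDERIV f x :> grad f x"
  unfolding F_coord_def by (auto intro: GDERIV_grad)

lemma F_coord_quadratic_upper_blk:
  assumes f: "f \<in> F_coord p b L" and i: "i \<in> {1..p}"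
  shows "f (x + blk b i h) \<le> f x + grad f x \<bullet> blk b i h + L i / 2 * (norm (blk b i h))\<^sup>2"
proof -
  let ?k = "blk b i h"
  let ?G = "\<lambda>t. grad f (x + t *\<^sub>R ?k)"
  have "?k \<bullet> (?G t - ?G 0) \<le> L i * t * (norm ?k)\<^sup>2" if t: "0 \<le> t" for t
  proof -
    have "?k \<bullet> (?G t - ?G 0) = ?k \<bullet> (blk b i (?G t) - blk b i (?G 0))"
      by (simp only: inner_blk_left flip: blk_diff)
    also have "\<dots> \<le> norm ?k * norm (blk b i (?G t) - blk b i (?G 0))"
      by (rule norm_cauchy_schwarz)
    also have "\<dots> \<le> norm ?k * (L i * norm (blk b i (t *\<^sub>R h)))"
    proof (rule mult_left_mono)
      have "norm (blk b i (grad f (x + blk b i (t *\<^sub>R h))) - blk b i (grad f x))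
          \<le> L i * norm (blk b i (t *\<^sub>R h))"
        using f i unfolding F_coord_def by blast
      then show "norm (blk b i (?G t) - blk b i (?G 0)) \<le> L i * norm (blk b i (t *\<^sub>R h))"
        by (simp add: blk_scaleR)
    qed simp
    finally show ?thesis using t by (simp add: blk_scaleR power2_eq_square mult_ac)
  qed
  from quadratic_upper_along_line[OF F_coord_GDERIV[OF f] this] show ?thesis by simp
qed

text \<open>
  The weights \<open>w\<^sub>i = L\<^sub>i / \<Sum>L\<^sub>j\<close> turn the block coefficients \<open>w\<^sub>i \<cdot> L\<^sub>i / (2 w\<^sub>i\<^sup>2)\<close> into one common
  coefficient, so that the squared block norms add up to \<open>\<parallel>h\<parallel>\<^sup>2\<close>. They must be positive, as the
  blocks of \<open>h\<close> are divided by them.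
\<close>

lemma F_coord_quadratic_upper_pos:
  assumes f: "f \<in> F_coord p b L" and b: "block_map p b" and p: "p \<ge> 1"
    and L: "\<And>i. i \<in> {1..p} \<Longrightarrow> L i > 0"
  shows "f (x + h) \<le> f x + grad f x \<bullet> h + (\<Sum>i=1..p. L i) / 2 * (norm h)\<^sup>2"
proof -
  let ?S = "\<Sum>i=1..p. L i"
  define w where "w i = L i / ?S" for i
  have S: "?S > 0" by (rule sum_pos) (use p L in auto)
  have w: "w i > 0" if "i \<in> {1..p}" for i using S L[OF that] by (simp add: w_def)
  have sw: "(\<Sum>i=1..p. w i) = 1"
    unfolding w_def using S by (simp flip: sum_divide_distrib)
  let ?y = "\<lambda>i. x + blk b i ((1 / w i) *\<^sub>R h)"
  have "(\<Sum>i=1..p. w i *\<^sub>R ?y i) = (\<Sum>i=1..p. w i *\<^sub>R x + blk b i h)"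
    by (rule sum.cong) (use w in \<open>auto simp: scaleR_add_right blk_scaleR\<close>, fastforce)
  also have "\<dots> = x + h"
    by (simp only: sum.distrib sum_blk[OF b] sw scaleR_one flip: scaleR_left.sum)
  finally have "f (x + h) = f (\<Sum>i=1..p. w i *\<^sub>R ?y i)" by simp
  also have "\<dots> \<le> (\<Sum>i=1..p. w i * f (?y i))"
    by (rule convex_on_sum[of _ UNIV])
      (use f p sw less_imp_le[OF w] in \<open>auto simp: F_coord_def\<close>)
  also have "\<dots> \<le> (\<Sum>i=1..p. w i * f x + blk b i (grad f x) \<bullet> blk b i h
      + ?S / 2 * (norm (blk b i h))\<^sup>2)"
  proof (rule sum_mono)
    fix i assume i: "i \<in> {1..p}"
    have "w i * f (?y i) \<le> w i * (f x + grad f x \<bullet> blk b i ((1 / w i) *\<^sub>R h)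
        + L i / 2 * (norm (blk b i ((1 / w i) *\<^sub>R h)))\<^sup>2)"
      by (intro mult_left_mono F_coord_quadratic_upper_blk[OF f i] less_imp_le[OF w[OF i]])
    also have "\<dots> = w i * f x + grad f x \<bullet> blk b i h + L i / (2 * w i) * (norm (blk b i h))\<^sup>2"
      using w[OF i] by (simp add: blk_scaleR field_simps power2_eq_square)
    also have "L i / (2 * w i) = ?S / 2" using L[OF i] S by (simp add: w_def)
    finally show "w i * f (?y i) \<le> w i * f x + blk b i (grad f x) \<bullet> blk b i h
      + ?S / 2 * (norm (blk b i h))\<^sup>2" by (simp only: inner_blk_right)
  qed
  also have "\<dots> = f x + grad f x \<bullet> h + ?S / 2 * (norm h)\<^sup>2"
    by (simp only: sum.distrib sum_inner_blk[OF b] sum_norm_blk[OF b] sw mult_1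
        flip: sum_distrib_left sum_distrib_right)
  finally show ?thesis .
qed

lemma F_coord_mono:
  assumes "f \<in> F_coord p b L" "\<And>i. i \<in> {1..p} \<Longrightarrow> L i \<le> L' i"
  shows "f \<in> F_coord p b L'"
  using assms unfolding F_coord_def
  by (smt (verit, best) mem_Collect_eq mult_right_mono norm_ge_zero)

text \<open>Zero constants give zero weights; enlarge all constants by \<open>e\<close> and let \<open>e\<close> tend to \<open>0\<close>.\<close>

lemma F_coord_quadratic_upper:
  assumes f: "f \<in> F_coord p b L" and b: "block_map p b" and p: "p \<ge> 1"
    and L: "\<And>i. i \<in> {1..p} \<Longrightarrow> L i \<ge> 0"
  shows "f (x + h) \<le> f x + grad f x \<bullet> h + (\<Sum>i=1..p. L i) / 2 * (norm h)\<^sup>2"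
proof (rule tendsto_lowerbound)
  let ?B = "\<lambda>e::real. f x + grad f x \<bullet> h + ((\<Sum>i=1..p. L i) + real p * e) / 2 * (norm h)\<^sup>2"
  have "isCont ?B 0" by (intro continuous_intros) auto
  then show "(?B \<longlongrightarrow> f x + grad f x \<bullet> h + (\<Sum>i=1..p. L i) / 2 * (norm h)\<^sup>2) (at_right 0)"
    by (auto simp: isCont_def intro: tendsto_mono[OF at_le])
  have "f (x + h) \<le> ?B e" if e: "e > 0" for e
  proof -
    have "f \<in> F_coord p b (\<lambda>i. L i + e)" by (rule F_coord_mono[OF f]) (use e in simp)
    from F_coord_quadratic_upper_pos[OF this b p] L e show ?thesis
      by (force simp: sum.distrib intro: add_nonneg_pos)
  qed
  then show "\<forall>\<^sub>F e in at_right 0. f (x + h) \<le> ?B e"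
    by (auto simp: eventually_at_right_less intro: eventually_mono[OF eventually_at_right_less])
qed simp

lemma F_coord_interpolation_ineq:
  assumes f: "f \<in> F_coord p b L" and b: "block_map p b" and p: "p \<ge> 1"
    and L: "\<And>i. i \<in> {1..p} \<Longrightarrow> L i \<ge> 0"
  shows "interpolation_ineq p b (\<Sum>i=1..p. L i) (y, grad f y, f y) (x, grad f x, f x)"
proof -
  let ?S = "\<Sum>i=1..p. L i"
  have lower: "f x + grad f x \<bullet> (y - x) \<le> f y" for x y
    by (rule convex_above_tangent[OF _ F_coord_GDERIV[OF f]]) (use f in \<open>simp add: F_coord_def\<close>)
  have upper: "f y \<le> f x + grad f x \<bullet> (y - x) + ?S / 2 * (norm (y - x))\<^sup>2" for x y
    using F_coord_quadratic_upper[OF f b p L, of x "y - x"] by simp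
  have "?S \<ge> 0" by (rule sum_nonneg) (use L in auto)
  then consider "?S = 0" | "?S > 0" by linarith
  then show ?thesis
  proof cases
    case 1
    have "grad f y = grad f x"
      by (rule affine_upper_imp_const_gradient[where f = f, OF lower])
        (use upper in \<open>simp only: 1, simp\<close>)
    with lower[of x y] show ?thesis unfolding 1 interpolation_ineq_0_iff[OF b] by simp
  next
    case 2
    then show ?thesis
      using cocoercive_inequality[where f = f, OF 2 lower upper] by (subst interpolation_ineq_iff[OF b]) auto
  qed
qed


section \<open>Worst cases\<close>

lemma W_coord_le_W_pep:
  assumes b: "block_map p b" and p: "p \<ge> 1" and L: "\<And>i. i \<in> {1..p} \<Longrightarrow> L i \<ge> 0"
  shows "W_coord p b J A P I L R \<le> W_pep p b J A P I (\<Sum>i=1..p. L i) R"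
  unfolding W_coord_def
proof (rule Sup_least, clarify)
  fix f and x :: "nat option \<Rightarrow> real^'a"
  assume f: "f \<in> F_coord p b L" and min: "minimizer f (x None)"
    and run: "run_on J A f (\<lambda>n. x (Some n))"
    and I: "I (oracle_family (star_index J) f x) \<le> R\<^sup>2"
  let ?O = "oracle_family (star_index J) f x"
  have "(\<lambda>n\<in>J. ?O (Some n)) = oracle_family J f (\<lambda>n. x (Some n))"
    by (auto simp: oracle_family_def star_index_def restrict_def)
  with run have "(\<lambda>n\<in>J. ?O (Some n)) \<in> A" by (simp add: run_on_def)
  moreover have "fst (snd (?O None)) = 0"
    using minimizer_GDERIV_eq_0[OF min F_coord_GDERIV[OF f]]
    by (simp add: oracle_family_def star_index_def)
  moreover have "interpolation_ineq p b (\<Sum>i=1..p. L i) (?O n) (?O l)"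
    if "n \<in> star_index J" "l \<in> star_index J" for n l
    using that F_coord_interpolation_ineq[OF f b p L] unfolding oracle_family_def by simp
  moreover have "?O \<in> star_index J \<rightarrow>\<^sub>E UNIV"
    by (simp add: oracle_family_def)
  ultimately have "?O \<in> pep_feasible p b J A I (\<Sum>i=1..p. L i) R"
    using I unfolding pep_feasible_def by blast
  then show "ereal (P ?O) \<le> W_pep p b J A P I (\<Sum>i=1..p. L i) R"
    unfolding W_pep_def by (rule SUP_upper)
qed

text \<open>
  A block Lipschitz condition is a Lipschitz condition between two points that differ in one block,
  so a common Lipschitz constant below all \<open>L i\<close> suffices.
\<close>

lemma Lipschitz_gradient_imp_F_coord:
  assumes "convex_on UNIV f" and D: "\<And>y. GDERIV f y :> D y"
    and Lip: "\<And>y z. norm (D z - D y) \<le> M * norm (z - y)"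
    and le: "\<And>i. i \<in> {1..p} \<Longrightarrow> M \<le> L i"
  shows "f \<in> F_coord p b L"
proof -
  have "norm (blk b i (D (x + blk b i h)) - blk b i (D x)) \<le> L i * norm (blk b i h)"
    if i: "i \<in> {1..p}" for i x h
  proof -
    have "norm (blk b i (D (x + blk b i h)) - blk b i (D x)) \<le> norm (D (x + blk b i h) - D x)"
      by (simp only: norm_blk_le flip: blk_diff)
    also have "\<dots> \<le> M * norm (blk b i h)" using Lip[of "x + blk b i h" x] by simp
    also have "\<dots> \<le> L i * norm (blk b i h)" by (intro mult_right_mono le i norm_ge_zero)
    finally show ?thesis .
  qed
  then show ?thesis
    unfolding F_coord_def using assms(1) GDERIV_imp_differentiable[OF D] grad_eqI[OF D] by simp
qed

text \<open>
  The index \<open>*\<close> takes part in the interpolation like any other. For \<open>M = 0\<close> the inequalities force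
  all gradients to equal that at \<open>*\<close>, which is \<open>0\<close>, and then all values to agree.
\<close>

lemma pep_feasible_interpolant:
  assumes O: "O' \<in> pep_feasible p b J A I M R" and b: "block_map p b" and J: "finite J"
    and M: "M \<ge> 0" and le: "\<And>i. i \<in> {1..p} \<Longrightarrow> M \<le> L i"
  obtains f where "f \<in> F_coord p b L"
    "\<And>n. n \<in> star_index J \<Longrightarrow> O' n = (fst (O' n), grad f (fst (O' n)), f (fst (O' n)))"
proof -
  let ?S = "star_index J"
  define x g v where "x n = fst (O' n)" and "g n = fst (snd (O' n))"
    and "v n = snd (snd (O' n))" for n
  have O_eq: "O' n = (x n, g n, v n)" for n by (simp add: x_def g_def v_def)
  have interp: "interpolation_ineq p b M (x n, g n, v n) (x l, g l, v l)"
    if "n \<in> ?S" "l \<in> ?S" for n l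
    using O that unfolding pep_feasible_def O_eq by blast
  have S: "finite ?S" "None \<in> ?S" using J by (auto simp: star_index_def)
  have "\<exists>f D. convex_on UNIV f \<and> (\<forall>y. GDERIV f y :> D y) \<and>
      (\<forall>y z. norm (D z - D y) \<le> M * norm (z - y)) \<and>
      (\<forall>n\<in>?S. f (x n) = v n \<and> D (x n) = g n)"
  proof (cases "M = 0")
    case True
    have g: "g n = 0" if "n \<in> ?S" for n
      using interp[OF that S(2)] O unfolding True interpolation_ineq_0_iff[OF b]
      by (simp add: pep_feasible_def g_def)
    then have v: "v n = v None" if "n \<in> ?S" for n
      using interp[OF that S(2)] interp[OF S(2) that] that S(2)
      unfolding True interpolation_ineq_0_iff[OF b] by simp
    have "convex_on UNIV (\<lambda>_. v None)" by (simp add: convex_on_const)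
    then show ?thesis
      using g v GDERIV_const True by (intro exI[of _ "\<lambda>_. v None"] exI[of _ "\<lambda>_. 0"]) auto
  next
    case False
    with M have pos: "M > 0" by simp
    have "v l + g l \<bullet> (x n - x l) + 1 / (2 * M) * (norm (g n - g l))\<^sup>2 \<le> v n"
      if "n \<in> ?S" "l \<in> ?S" for n l
      using interp[OF that] unfolding interpolation_ineq_iff[OF b False] .
    from smooth_convex_interpolation[of ?S M v g x, OF S(1) _ pos this] S(2)
    show ?thesis by (metis empty_iff)
  qed
  then obtain f D where f: "convex_on UNIV f" and D: "\<And>y. GDERIV f y :> D y"
    and Lip: "\<And>y z. norm (D z - D y) \<le> M * norm (z - y)"
    and fS: "\<And>n. n \<in> ?S \<Longrightarrow> f (x n) = v n \<and> D (x n) = g n" by blast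
  have "f \<in> F_coord p b L" by (rule Lipschitz_gradient_imp_F_coord[OF f D Lip le])
  moreover have "O' n = (fst (O' n), grad f (fst (O' n)), f (fst (O' n)))" if "n \<in> ?S" for n
    using fS[OF that] grad_eqI[OF D] by (simp add: x_def g_def v_def prod_eq_iff)
  ultimately show thesis by (rule that)
qed

lemma W_pep_le_W_coord:
  assumes b: "block_map p b" and J: "finite J"
    and M: "M \<ge> 0" and le: "\<And>i. i \<in> {1..p} \<Longrightarrow> M \<le> L i"
  shows "W_pep p b J A P I M R \<le> W_coord p b J A P I L R"
  unfolding W_pep_def
proof (rule SUP_least)
  fix O' assume O: "O' \<in> pep_feasible p b J A I M R"
  let ?x = "\<lambda>n. fst (O' n)"
  obtain f where f: "f \<in> F_coord p b L"
    and fO: "\<And>n. n \<in> star_index J \<Longrightarrow> O' n = (?x n, grad f (?x n), f (?x n))"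
    using pep_feasible_interpolant[OF O b J M, of L] le by blast
  have "O' \<in> star_index J \<rightarrow>\<^sub>E UNIV" using O by (simp add: pep_feasible_def)
  then have O_eq: "oracle_family (star_index J) f ?x = O'"
    unfolding oracle_family_def by (intro extensionalityI[of _ "star_index J"]) (auto simp: PiE_def simp flip: fO)
  have "oracle_family J f (\<lambda>n. ?x (Some n)) = (\<lambda>n\<in>J. O' (Some n))"
    unfolding oracle_family_def by (intro restrict_ext fO[symmetric]) (simp add: star_index_def)
  then have run: "run_on J A f (\<lambda>n. ?x (Some n))"
    using O by (simp add: run_on_def pep_feasible_def)
  (* A point where the gradient of a convex function vanishes is a minimizer. *)
  have "grad f (?x None) = 0"
    using O fO[of None] unfolding pep_feasible_def star_index_def
    by (metis (mono_tags, lifting) fst_conv insertI1 mem_Collect_eq snd_conv)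
  then have min: "minimizer f (?x None)"
    using convex_above_tangent[OF _ F_coord_GDERIV[OF f, of "?x None"]] f
    by (simp add: minimizer_def F_coord_def)
  have "I O' \<le> R\<^sup>2" using O by (simp add: pep_feasible_def)
  then have "\<exists>f x. ereal (P O') = ereal (P (oracle_family (star_index J) f x)) \<and>
      f \<in> F_coord p b L \<and> minimizer f (x None) \<and> run_on J A f (\<lambda>n. x (Some n)) \<and>
      I (oracle_family (star_index J) f x) \<le> R\<^sup>2"
    using f min run O_eq by (intro exI[of _ f] exI[of _ ?x]) auto
  then show "ereal (P O') \<le> W_coord p b J A P I L R"
    unfolding W_coord_def by (intro Sup_upper) blast
qed

theorem theorem3p2:
  fixes p K :: nat and R :: real and L :: "nat \<Rightarrow> real"
    and b :: "'d::finite \<Rightarrow> nat"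
    and J :: "nat set" and A :: "(nat \<Rightarrow> 'd triple) set"
    and P I :: "(nat option \<Rightarrow> 'd triple) \<Rightarrow> real"
  assumes "p \<ge> 1" and "K \<ge> 1" and "R > 0"
    and "block_map p b"
    and "\<forall>i\<in>{1..p}. L i \<ge> 0"
    and "block_coordinate_algorithm p K J A"
  shows "W_pep p b J A P I (Min (L ` {1..p})) R \<le> W_coord p b J A P I L R
       \<and> W_coord p b J A P I L R \<le> W_pep p b J A P I (\<Sum>i=1..p. L i) R"
proof
  have J: "finite J" using assms(6) by (simp add: block_coordinate_algorithm_def)
  show "W_pep p b J A P I (Min (L ` {1..p})) R \<le> W_coord p b J A P I L R"
    by (rule W_pep_le_W_coord[OF assms(4) J]) (use assms(1,5) in \<open>auto intro: Min_le\<close>)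
  show "W_coord p b J A P I L R \<le> W_pep p b J A P I (\<Sum>i=1..p. L i) R"
    by (rule W_coord_le_W_pep) (use assms in auto)
qed

end
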